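(* Let $\vartheta \in \mathbb{R}$, $\tau > 0$, and let $X \sim N(\vartheta, \tau^2)$ be a real Gaussian random variable with mean $\vartheta$ and variance $\tau^2$. Then for every integer $l \geq 1$, $$\mathbb{E}\left[\log(1 + \exp(X))\right] \leq \eta_l(\vartheta, \tau),$$ where $$\eta_l(\vartheta, \tau) = \frac{\tau}{\sqrt{2\pi}} e^{-\frac{\vartheta^2}{2\tau^2}} + \vartheta\, \Phi\left(\frac{\vartheta}{\tau}\right) + \sum_{k=1}^{2l-1} \frac{(-1)^{k-1}}{k} \left[ e^{k\vartheta + k^2\tau^2/2}\, \Phi\left(-\frac{\vartheta}{\tau} - k\tau\right) + e^{-k\vartheta + k^2\tau^2/2}\, \Phi\left(\frac{\vartheta}{\tau} - k\tau\right) \right].$$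
   Context: $\Phi$ denotes the cumulative distribution function of the standard normal distribution $N(0,1)$, and $\log$ is the natural logarithm. *)

theory Defs
  imports "HOL-Probability.Probability"
begin

definition Phi :: "real \<Rightarrow> real" where
  "Phi x = cdf std_normal_distribution x"

definition eta :: "nat \<Rightarrow> real \<Rightarrow> real \<Rightarrow> real" where
  "eta l \<theta> \<tau> =
     \<tau> / sqrt (2 * pi) * exp (- (\<theta>\<^sup>2 / (2 * \<tau>\<^sup>2))) + \<theta> * Phi (\<theta> / \<tau>)
     + (\<Sum>k = 1..2 * l - 1. (-1) ^ (k - 1) / real k *
         (exp (real k * \<theta> + (real k)\<^sup>2 * \<tau>\<^sup>2 / 2) * Phi (- (\<theta> / \<tau>) - real k * \<tau>)
          + exp (- real k * \<theta> + (real k)\<^sup>2 * \<tau>\<^sup>2 / 2) * Phi (\<theta> / \<tau> - real k * \<tau>)))"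

end

theory Submission
  imports Defs "HOL-Real_Asymp.Real_Asymp"
begin

text \<open>
  Write \<open>ln (1 + exp x) = max x 0 + ln (1 + exp (- \<bar>x\<bar>))\<close> and bound the second summand by an
  odd partial sum of the alternating series of \<open>ln (1 + u)\<close> at \<open>u = exp (- \<bar>x\<bar>)\<close>.
  Each resulting term is integrated exactly against the Gaussian density, since multiplying that
  density by \<open>exp (c * x)\<close> only shifts its mean, up to a constant factor.
\<close>

text \<open>The difference of the two sides vanishes at \<open>0\<close>. By the geometric sum its
  derivative is \<open>(1 - (- x) ^ n) / (1 + x) - 1 / (1 + x)\<close>, which for odd
  \<open>n\<close> is \<open>x ^ n / (1 + x)\<close>, hence nonnegative. No convergence of the
  series is involved, so \<open>u\<close> may exceed 1.\<close>

lemma ln_add_one_le_sum_odd: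
  fixes u :: real
  assumes "0 \<le> u" and "odd n"
  shows "ln (1 + u) \<le> (\<Sum>k = 1..n. (-1) ^ (k - 1) / real k * u ^ k)"
proof -
  let ?F = "\<lambda>u::real. (\<Sum>k<n. (-1) ^ k / real (Suc k) * u ^ Suc k) - ln (1 + u)"
  have "?F 0 \<le> ?F u"
  proof (rule DERIV_nonneg_imp_nondecreasing[OF assms(1)])
    fix x :: real
    assume x: "0 \<le> x" "x \<le> u"
    have "(?F has_real_derivative (\<Sum>k<n. (- x) ^ k) - 1 / (1 + x)) (at x)"
      using x by (auto intro!: derivative_eq_intros sum.cong simp: power_minus[of x] simp del: power_Suc)
    moreover have "(\<Sum>k<n. (- x) ^ k) - 1 / (1 + x) = x ^ n / (1 + x)"
      using one_diff_power_eq[of "- x" n] x \<open>odd n\<close> by (simp add: field_simps)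
    moreover have "x ^ n / (1 + x) \<ge> 0"
      using x by simp
    ultimately show "\<exists>y. (?F has_real_derivative y) (at x) \<and> 0 \<le> y"
      by auto
  qed
  moreover have "(\<Sum>k = 1..n. (-1) ^ (k - 1) / real k * u ^ k) =
      (\<Sum>k<n. (-1) ^ k / real (Suc k) * u ^ Suc k)"
    by (simp add: sum.atLeast1_atMost_eq)
  ultimately show ?thesis
    by simp
qed

lemma Phi_has_bochner_integral:
  "has_bochner_integral lborel (\<lambda>x. std_normal_density x * indicator {..a} x) (Phi a)"
proof -
  have int: "integrable lborel (\<lambda>x. std_normal_density x * indicator {..a} x)"
    by (rule integrable_real_mult_indicator) auto
  interpret prob_space std_normal_distribution
    by (rule prob_space_normal_density) simp
  have "Phi a = (\<integral>x. indicator {..a} x \<partial>std_normal_distribution)"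
    by (simp add: Phi_def cdf_def)
  also have "\<dots> = (\<integral>x. std_normal_density x * indicator {..a} x \<partial>lborel)"
    by (subst integral_real_density) auto
  finally show ?thesis
    using int by (simp add: has_bochner_integral_iff)
qed

text \<open>The second form uses that the standard density is even; it fits the reflecting
  substitution that turns an upper half-line into a lower one.\<close>

lemma normal_density_standardize:
  assumes "0 < \<tau>"
  shows "normal_density m \<tau> x = std_normal_density ((x - m) / \<tau>) / \<tau>"
    and "normal_density m \<tau> x = std_normal_density ((m - x) / \<tau>) / \<tau>"
  using assms by (simp_all add: normal_density_def real_sqrt_mult power_divide power2_commute field_simps)

lemma normal_density_has_bochner_integral_atMost:
  assumes \<tau>: "0 < \<tau>"
  shows "has_bochner_integral lborel (\<lambda>x. normal_density m \<tau> x * indicator {..0} x) (Phi (- m / \<tau>))"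
proof -
  \<comment> \<open>The increasing substitution \<open>(x - m) / \<tau>\<close> carries
    \<open>{..0}\<close> to \<open>{..- m / \<tau>}\<close>; its slope produces the factor \<tau>
    that is divided out at the end.\<close>
  have "has_bochner_integral lborel
      (\<lambda>x. std_normal_density (- m / \<tau> + (1 / \<tau>) * x) * indicator {..- m / \<tau>} (- m / \<tau> + (1 / \<tau>) * x))
      (Phi (- m / \<tau>) /\<^sub>R \<bar>1 / \<tau>\<bar>)"
    using \<tau> by (subst lborel_has_bochner_integral_real_affine_iff[symmetric])
      (auto intro: Phi_has_bochner_integral)
  then have "has_bochner_integral lborel
      (\<lambda>x. std_normal_density ((x - m) / \<tau>) * indicator {..0} x) (\<tau> * Phi (- m / \<tau>))"
    by (rule has_bochner_integral_cong[THEN iffD1, rotated -1])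
      (use \<tau> in \<open>auto simp: indicator_def field_simps mult_le_0_iff zero_le_mult_iff\<close>)
  from has_bochner_integral_mult_left[of "1 / \<tau>", OF this] show ?thesis
    by (rule has_bochner_integral_cong[THEN iffD1, rotated -1])
      (use \<tau> in \<open>auto simp: normal_density_standardize(1)[of \<tau> m]\<close>)
qed

lemma normal_density_has_bochner_integral_greaterThan:
  assumes \<tau>: "0 < \<tau>"
  shows "has_bochner_integral lborel (\<lambda>x. normal_density m \<tau> x * indicator {0<..} x) (Phi (m / \<tau>))"
proof -
  \<comment> \<open>The substitution now has negative slope: \<open>(m - x) / \<tau>\<close> carries
    \<open>{0..}\<close> to \<open>{..m / \<tau>}\<close>, so \<open>Phi\<close> applies without
    passing to a complement.\<close>
  have "has_bochner_integral lborel
      (\<lambda>x. std_normal_density (m / \<tau> + (- 1 / \<tau>) * x) * indicator {..m / \<tau>} (m / \<tau> + (- 1 / \<tau>) * x))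
      (Phi (m / \<tau>) /\<^sub>R \<bar>- 1 / \<tau>\<bar>)"
    using \<tau> by (subst lborel_has_bochner_integral_real_affine_iff[symmetric])
      (auto intro: Phi_has_bochner_integral)
  then have "has_bochner_integral lborel
      (\<lambda>x. std_normal_density ((m - x) / \<tau>) * indicator {0..} x) (\<tau> * Phi (m / \<tau>))"
    by (rule has_bochner_integral_cong[THEN iffD1, rotated -1])
      (use \<tau> in \<open>auto simp: indicator_def field_simps mult_le_0_iff zero_le_mult_iff\<close>)
  from has_bochner_integral_mult_left[of "1 / \<tau>", OF this]
  have "has_bochner_integral lborel (\<lambda>x. normal_density m \<tau> x * indicator {0..} x) (Phi (m / \<tau>))"
    by (rule has_bochner_integral_cong[THEN iffD1, rotated -1])
      (use \<tau> in \<open>auto simp: normal_density_standardize(2)[of \<tau> m]\<close>)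
  \<comment> \<open>Reflection yields the closed half-line; the point \<open>0\<close> is a null
    set.\<close>
  then show ?thesis
    by (rule has_bochner_integralI_AE)
      (use AE_lborel_singleton[of 0] in \<open>auto simp: indicator_def elim!: eventually_mono\<close>)
qed

text \<open>Completing the square in the exponent: the tilt moves the mean by
  \<open>c * \<tau>\<^sup>2\<close> and leaves the variance unchanged.\<close>

lemma exp_mult_normal_density:
  assumes "0 < \<tau>"
  shows "normal_density \<theta> \<tau> x * exp (c * x) =
    exp (c * \<theta> + c\<^sup>2 * \<tau>\<^sup>2 / 2) * normal_density (\<theta> + c * \<tau>\<^sup>2) \<tau> x"
proof -
  have "- (x - \<theta>)\<^sup>2 / (2 * \<tau>\<^sup>2) + c * x =
      c * \<theta> + c\<^sup>2 * \<tau>\<^sup>2 / 2 + - (x - (\<theta> + c * \<tau>\<^sup>2))\<^sup>2 / (2 * \<tau>\<^sup>2)"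
    using assms by (simp add: field_simps power2_eq_square)
  then show ?thesis
    unfolding normal_density_def by (simp add: exp_add[symmetric])
qed

lemma normal_density_exp_has_bochner_integral_atMost:
  assumes \<tau>: "0 < \<tau>"
  shows "has_bochner_integral lborel (\<lambda>x. normal_density \<theta> \<tau> x * (indicator {..0} x * exp (c * x)))
    (exp (c * \<theta> + c\<^sup>2 * \<tau>\<^sup>2 / 2) * Phi (- (\<theta> / \<tau>) - c * \<tau>))"
proof -
  have eq: "- (\<theta> / \<tau>) - c * \<tau> = - (\<theta> + c * \<tau>\<^sup>2) / \<tau>"
    using \<tau> by (simp add: field_simps power2_eq_square)
  have "has_bochner_integral lborel
      (\<lambda>x. exp (c * \<theta> + c\<^sup>2 * \<tau>\<^sup>2 / 2) *
        (normal_density (\<theta> + c * \<tau>\<^sup>2) \<tau> x * indicator {..0} x))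
      (exp (c * \<theta> + c\<^sup>2 * \<tau>\<^sup>2 / 2) * Phi (- (\<theta> / \<tau>) - c * \<tau>))"
    unfolding eq
    by (intro has_bochner_integral_mult_right normal_density_has_bochner_integral_atMost \<tau>)
  then show ?thesis
    unfolding mult.assoc[symmetric] exp_mult_normal_density[OF \<tau>, symmetric]
    by (simp add: mult_ac)
qed

lemma normal_density_exp_has_bochner_integral_greaterThan:
  assumes \<tau>: "0 < \<tau>"
  shows "has_bochner_integral lborel (\<lambda>x. normal_density \<theta> \<tau> x * (indicator {0<..} x * exp (- c * x)))
    (exp (- c * \<theta> + c\<^sup>2 * \<tau>\<^sup>2 / 2) * Phi (\<theta> / \<tau> - c * \<tau>))"
proof -
  \<comment> \<open>The right-hand side is the mean after tilting with \<open>- c\<close>, divided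
    by \<tau>, as the upper half-line integral requires.\<close>
  have eq: "\<theta> / \<tau> - c * \<tau> = (\<theta> + (- c) * \<tau>\<^sup>2) / \<tau>"
    using \<tau> by (simp add: field_simps power2_eq_square)
  have "has_bochner_integral lborel
      (\<lambda>x. exp (- c * \<theta> + (- c)\<^sup>2 * \<tau>\<^sup>2 / 2) *
        (normal_density (\<theta> + (- c) * \<tau>\<^sup>2) \<tau> x * indicator {0<..} x))
      (exp (- c * \<theta> + (- c)\<^sup>2 * \<tau>\<^sup>2 / 2) * Phi (\<theta> / \<tau> - c * \<tau>))"
    unfolding eq
    by (intro has_bochner_integral_mult_right normal_density_has_bochner_integral_greaterThan \<tau>)
  then show ?thesis
    unfolding mult.assoc[symmetric] exp_mult_normal_density[OF \<tau>, symmetric]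
    by (simp add: mult_ac)
qed

text \<open>The integrand is the derivative of \<open>- (\<tau>\<^sup>2)\<close> times the density,
  so the integral equals \<open>\<tau>\<^sup>2\<close> times the density at
  \<open>0\<close>.\<close>

lemma normal_density_deviation_has_bochner_integral_greaterThan:
  assumes \<tau>: "0 < \<tau>"
  shows "has_bochner_integral lborel (\<lambda>x. normal_density \<theta> \<tau> x * (x - \<theta>) * indicator {0<..} x)
    (\<tau> / sqrt (2 * pi) * exp (- (\<theta>\<^sup>2 / (2 * \<tau>\<^sup>2))))"
proof -
  let ?f = "\<lambda>x. normal_density \<theta> \<tau> x * (x - \<theta>)"
  let ?F = "\<lambda>x. - (\<tau>\<^sup>2) * normal_density \<theta> \<tau> x"
  have int: "integrable lborel (\<lambda>x. ?f x * indicator {0<..} x)"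
    using integrable_normal_moment[OF \<tau>, of \<theta> 1] by (intro integrable_real_mult_indicator) auto
  have deriv: "(?F has_real_derivative ?f x) (at x)" for x
  proof -
    \<comment> \<open>An arbitrary \<open>c\<close> stands for the normalising factor, which keeps
      its square root out of the differentiation.\<close>
    have "((\<lambda>x. c * exp (- (x - \<theta>)\<^sup>2 / (2 * \<tau>\<^sup>2))) has_real_derivative
        c * exp (- (x - \<theta>)\<^sup>2 / (2 * \<tau>\<^sup>2)) * (- (x - \<theta>) / \<tau>\<^sup>2)) (at x)" for c
      using \<tau> by (auto intro!: derivative_eq_intros simp: field_simps power2_eq_square power4_eq_xxxx)
    from DERIV_cmult[OF this, of "- (\<tau>\<^sup>2)"] show ?thesis
      unfolding normal_density_def by (rule DERIV_cong) (use \<tau> in \<open>simp add: right_diff_distrib diff_divide_distrib\<close>)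
  qed
  \<comment> \<open>The first \<open>0\<close> is the limit of the antiderivative at
    infinity.\<close>
  have "(LBINT x=0..\<infinity>. ?f x) = 0 - ?F 0"
  proof (rule interval_integral_FTC_integrable[where F = ?F])
    show "(?F has_vector_derivative ?f x) (at x)" for x
      using deriv by (simp add: has_real_derivative_iff_has_vector_derivative)
    show "isCont ?f x" for x
      unfolding normal_density_def using \<tau> by (intro continuous_intros) auto
    show "set_integrable lborel (einterval 0 \<infinity>) ?f"
      using int by (simp add: set_integrable_def zero_ereal_def mult.commute)
    have "isCont ?F 0"
      using deriv DERIV_isCont by blast
    then have "(?F \<longlongrightarrow> ?F 0) (at_right 0)"
      by (simp add: isCont_def filterlim_at_split)
    then show "((?F \<circ> real_of_ereal) \<longlongrightarrow> ?F 0) (at_right 0)"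
      unfolding zero_ereal_def ereal_tendsto_simps .
    have "(?F \<longlongrightarrow> 0) at_top"
      unfolding normal_density_def using \<tau> by real_asymp
    then show "((?F \<circ> real_of_ereal) \<longlongrightarrow> 0) (at_left \<infinity>)"
      unfolding ereal_tendsto_simps .
  qed simp
  moreover have "(LBINT x=0..\<infinity>. ?f x) = (\<integral>x. ?f x * indicator {0<..} x \<partial>lborel)"
    by (simp add: interval_integral_to_infinity_eq zero_ereal_def set_lebesgue_integral_def mult.commute)
  moreover have "- ?F 0 = \<tau> / sqrt (2 * pi) * exp (- (\<theta>\<^sup>2 / (2 * \<tau>\<^sup>2)))"
    using \<tau> by (simp add: normal_density_def real_sqrt_mult power2_eq_square)
  ultimately show ?thesis
    using int by (simp add: has_bochner_integral_iff)
qed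

text \<open>On \<open>{0<..}\<close> the maximum is \<open>x = (x - \<theta>) + \<theta>\<close>;
  the deviation gives the exponential term and the constant gives the \<open>Phi\<close>
  term.\<close>

lemma normal_density_max_has_bochner_integral:
  assumes \<tau>: "0 < \<tau>"
  shows "has_bochner_integral lborel (\<lambda>x. normal_density \<theta> \<tau> x * max x 0)
    (\<tau> / sqrt (2 * pi) * exp (- (\<theta>\<^sup>2 / (2 * \<tau>\<^sup>2))) + \<theta> * Phi (\<theta> / \<tau>))"
  using has_bochner_integral_add[OF normal_density_deviation_has_bochner_integral_greaterThan[OF \<tau>]
      has_bochner_integral_mult_right[of \<theta>, OF normal_density_has_bochner_integral_greaterThan[OF \<tau>]]]
  by (rule has_bochner_integral_cong[THEN iffD1, rotated -1])
    (auto simp: indicator_def algebra_simps)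

text \<open>For \<open>0 \<le> x\<close> factor out \<open>exp x\<close>; for negative
  \<open>x\<close> both sides agree literally.\<close>

lemma softplus_eq: "ln (1 + exp x) = max x 0 + ln (1 + exp (- \<bar>x\<bar>))" for x :: real
proof (cases "0 \<le> x")
  case True
  have "1 + exp x = exp x * (1 + exp (- x))"
    by (simp add: exp_minus field_simps)
  also have "ln \<dots> = x + ln (1 + exp (- x))"
    by (subst ln_mult_pos) (auto intro: add_pos_pos)
  finally show ?thesis
    using True by simp
qed simp

text \<open>The bracket is \<open>exp (- \<bar>x\<bar>) ^ k\<close>, split by the sign of
  \<open>x\<close> so that each piece is a pure exponential on a half-line. The point
  \<open>0\<close> belongs to the left piece only, so nothing is counted twice.\<close>

definition softplus_bound :: "nat \<Rightarrow> real \<Rightarrow> real" where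
  "softplus_bound n x = max x 0 + (\<Sum>k = 1..n. (-1) ^ (k - 1) / real k *
     (indicator {..0} x * exp (real k * x) + indicator {0<..} x * exp (- real k * x)))"

lemma softplus_le_bound:
  assumes "odd n"
  shows "ln (1 + exp x) \<le> softplus_bound n x"
proof -
  have "exp (- \<bar>x\<bar>) ^ k = indicator {..0} x * exp (real k * x) + indicator {0<..} x * exp (- real k * x)"
    for k
    by (cases "0 < x") (simp_all add: exp_of_nat_mult[symmetric])
  then show ?thesis
    using ln_add_one_le_sum_odd[OF _ assms, of "exp (- \<bar>x\<bar>)"]
    unfolding softplus_eq[of x] softplus_bound_def by simp
qed

lemma softplus_bound_has_bochner_integral:
  assumes \<tau>: "0 < \<tau>"
  shows "has_bochner_integral lborel (\<lambda>x. normal_density \<theta> \<tau> x * softplus_bound (2 * l - 1) x)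
    (eta l \<theta> \<tau>)"
proof -
  \<comment> \<open>The density is first distributed over all summands, so that the integrand
    matches \<open>eta\<close> term by term; the two half-lines yield its two \<open>Phi\<close>
    terms for each \<open>k\<close>.\<close>
  have "has_bochner_integral lborel
      (\<lambda>x. normal_density \<theta> \<tau> x * max x 0 + (\<Sum>k = 1..2 * l - 1. (-1) ^ (k - 1) / real k *
        (normal_density \<theta> \<tau> x * (indicator {..0} x * exp (real k * x))
         + normal_density \<theta> \<tau> x * (indicator {0<..} x * exp (- real k * x)))))
      (eta l \<theta> \<tau>)"
    unfolding eta_def
    by (intro has_bochner_integral_add has_bochner_integral_sum has_bochner_integral_mult_right
        normal_density_max_has_bochner_integral normal_density_exp_has_bochner_integral_atMost
        normal_density_exp_has_bochner_integral_greaterThan \<tau>)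
  then show ?thesis
    by (rule has_bochner_integral_cong[THEN iffD1, rotated -1])
      (auto simp: softplus_bound_def distrib_left sum_distrib_left mult_ac simp flip: sum.distrib)
qed

theorem theorem2p1:
  fixes M :: "'a measure" and X :: "'a \<Rightarrow> real" and \<theta> \<tau> :: real and l :: nat
  assumes "prob_space M"
    and "\<tau> > 0"
    and "distributed M lborel X (normal_density \<theta> \<tau>)"
    and "l \<ge> 1"
  shows "integrable M (\<lambda>\<omega>. ln (1 + exp (X \<omega>))) \<and>
         prob_space.expectation M (\<lambda>\<omega>. ln (1 + exp (X \<omega>))) \<le> eta l \<theta> \<tau>"
proof -
  let ?b = "\<lambda>x. normal_density \<theta> \<tau> x * softplus_bound (2 * l - 1) x"
  let ?s = "\<lambda>x. normal_density \<theta> \<tau> x * ln (1 + exp x)"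
  have b: "integrable lborel ?b" "(\<integral>x. ?b x \<partial>lborel) = eta l \<theta> \<tau>"
    using softplus_bound_has_bochner_integral[OF assms(2)] by (auto simp: has_bochner_integral_iff)
  \<comment> \<open>\<open>l \<ge> 1\<close> makes \<open>2 * l - 1\<close> odd; truncated
    subtraction would give \<open>0\<close> at \<open>l = 0\<close>.\<close>
  have le: "?s x \<le> ?b x" for x
    using assms(4) by (intro mult_left_mono softplus_le_bound) auto
  have nonneg: "0 \<le> ?s x" for x
    by simp
  \<comment> \<open>Since \<open>?s\<close> is nonnegative, the pointwise bound is also a bound in
    norm, and integrability follows by domination.\<close>
  have s: "integrable lborel ?s"
  proof (rule Bochner_Integration.integrable_bound[OF b(1)])
    have "norm (?s x) \<le> norm (?b x)" for x
      using le[of x] nonneg[of x] unfolding real_norm_def by linarith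
    then show "AE x in lborel. norm (?s x) \<le> norm (?b x)"
      by simp
  qed simp
  have "(\<integral>x. ?s x \<partial>lborel) \<le> eta l \<theta> \<tau>"
    using integral_mono[OF s b(1) le] b(2) by simp
  \<comment> \<open>Both claims on \<open>M\<close> are transferred from \<open>lborel\<close>
    through the density of \<open>X\<close>.\<close>
  then show ?thesis
    using s distributed_integrable[OF assms(3), of "\<lambda>x. ln (1 + exp x)"]
      distributed_integral[OF assms(3), of "\<lambda>x. ln (1 + exp x)"]
    by simp
qed

end
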